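(* Let $k$ be a nonnegative integer. Then $${\rm ord}_2(t^o_{4k+1})=k+{\rm ord}_2(k)+\chi_e(k).$$
   Context: $t^o_n$ is the number of involutions of $[n]$ (permutations with $\pi^2=1$) having an odd number of 2-cycles. $\chi_e(k)=1$ if $k$ is even and $0$ otherwise. ${\rm ord}_2(m)$ is the largest integer $e$ with $2^e\mid m$, with the convention ${\rm ord}_2(0)=+\infty$. *)

theory Defs
  imports Main "HOL-Library.Extended_Nat" "HOL-Computational_Algebra.Primes"
    "HOL-Combinatorics.Permutations" "HOL-Combinatorics.Orbits"
begin

text \<open>The identity counts as an involution.\<close>

definition involutions :: "nat \<Rightarrow> (nat \<Rightarrow> nat) set" where
  "involutions n = {p. p permutes {1..n} \<and> p \<circ> p = id}"

text \<open>The cycles of a permutation of \<open>{1..n}\<close> are identified with its orbits, so a 2-cycle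
  is a two-element orbit.\<close>

definition two_cycles :: "(nat \<Rightarrow> nat) \<Rightarrow> nat \<Rightarrow> nat set set" where
  "two_cycles p n = {c \<in> orbit p ` {1..n}. card c = 2}"

definition t_odd :: "nat \<Rightarrow> nat" where
  "t_odd n = card {p \<in> involutions n. odd (card (two_cycles p n))}"

definition chi_even :: "nat \<Rightarrow> nat" where
  "chi_even k = (if even k then 1 else 0)"

text \<open>The library's \<open>multiplicity 2 0\<close> is \<open>0\<close>, whereas here the 2-adic order of \<open>0\<close> is infinite.\<close>

definition ord2 :: "nat \<Rightarrow> enat" where
  "ord2 m = (if m = 0 then \<infinity> else enat (multiplicity 2 m))"

end

theory Submission
  imports Defs "HOL-Computational_Algebra.Polynomial"
begin

text \<open>Let \<open>t\<close> and \<open>s\<close> count involutions without and with the sign \<open>(-1)\<close> to the number of 2-cycles,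
  so that \<open>t - s\<close> is twice the wanted number. Both satisfy a second-order recurrence, and after
  four steps a power of 2 splits off: \<open>t (4 k + 1) = 2 ^ k * b k\<close> and
  \<open>t (4 k) = 2 ^ k * (b k + 4 * e k)\<close>, and likewise for \<open>s\<close>. For odd \<open>k\<close> the claim follows modulo 4.
  For \<open>k = 2 l\<close>, the \<open>j\<close>-th differences of \<open>b (2 l)\<close> with respect to \<open>l\<close> turn out to be divisible
  by \<open>2 ^ j\<close>. Hence in the Newton expansion of the difference of the two \<open>b (2 l)\<close>, which vanishes
  at \<open>l = 0\<close>, the linear term \<open>8 * 81 * l\<close> dominates 2-adically, because \<open>l choose j\<close>
  is an integral multiple of \<open>l / j\<close>; only the coefficients with \<open>j \<le> 4\<close> need to be computed.\<close>

section \<open>Counting involutions by the parity of the number of 2-cycles\<close>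

text \<open>For an involution these pairs are its 2-cycles. Unlike \<open>two_cycles\<close>, no
  ground set is mentioned, so points can be added to it or removed from it freely.\<close>

definition moved_pairs :: "('a \<Rightarrow> 'a) \<Rightarrow> 'a set set" where
  "moved_pairs p = (\<lambda>x. {x, p x}) ` {x. p x \<noteq> x}"

definition parity_involutions :: "bool \<Rightarrow> 'a set \<Rightarrow> ('a \<Rightarrow> 'a) set" where
  "parity_involutions s A =
     {p. p permutes A \<and> p \<circ> p = id \<and> (odd (card (moved_pairs p)) \<longleftrightarrow> s)}"

fun inv_count :: "bool \<Rightarrow> nat \<Rightarrow> nat" where
  "inv_count s 0 = (if s then 0 else 1)"
| "inv_count s (Suc 0) = (if s then 0 else 1)"
| "inv_count s (Suc (Suc n)) = inv_count s (Suc n) + Suc n * inv_count (\<not> s) n"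

lemma orbit_involution:
  assumes "p \<circ> p = id"
  shows "orbit p x = {x, p x}"
proof -
  have pp: "p (p y) = y" for y
    using assms by (metis comp_apply id_apply)
  show ?thesis
  proof
    show "orbit p x \<subseteq> {x, p x}"
    proof
      fix y assume "y \<in> orbit p x"
      then show "y \<in> {x, p x}" by induction (auto simp: pp)
    qed
    have "p x \<in> orbit p x" by (rule orbit.base)
    then have "p (p x) \<in> orbit p x" by (rule orbit.step)
    then show "{x, p x} \<subseteq> orbit p x" using \<open>p x \<in> orbit p x\<close> by (simp add: pp)
  qed
qed

lemma two_cycles_eq_moved_pairs:
  assumes "p \<in> involutions n"
  shows "two_cycles p n = moved_pairs p"
proof -
  have p: "p permutes {1..n}" "p \<circ> p = id" using assms by (auto simp: involutions_def)
  have "p x \<noteq> x \<Longrightarrow> x \<in> {1..n}" for x using p(1) by (meson permutes_def)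
  then show ?thesis
    by (auto simp: two_cycles_def moved_pairs_def orbit_involution[OF p(2)] card_insert_if
        split: if_splits)
qed

lemma t_odd_eq_card: "t_odd n = card (parity_involutions True {1..n})"
proof -
  have "{p \<in> involutions n. odd (card (two_cycles p n))} = parity_involutions True {1..n}"
    using two_cycles_eq_moved_pairs
    by (auto simp: parity_involutions_def involutions_def)
  then show ?thesis by (simp add: t_odd_def)
qed

lemma finite_moved_pairs:
  assumes "p permutes A" "finite A"
  shows "finite (moved_pairs p)"
proof -
  have "{x. p x \<noteq> x} \<subseteq> A" using assms(1) by (auto simp: permutes_def)
  then show ?thesis unfolding moved_pairs_def using assms(2) by (meson finite_imageI finite_subset)
qed

lemma finite_parity_involutions: "finite A \<Longrightarrow> finite (parity_involutions s A)"
  by (rule finite_subset[OF _ finite_permutations]) (auto simp: parity_involutions_def)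

text \<open>Both \<open>a\<close> and \<open>b\<close> are fixed by \<open>p\<close>, so composing
  with the swap only adds the pair \<open>{a, b}\<close> and thereby flips the parity.\<close>

lemma transpose_comp_involution:
  assumes p: "p permutes A" "p \<circ> p = id" and ab: "a \<notin> A" "b \<notin> A" "a \<noteq> b" and fin: "finite A"
  defines "q \<equiv> transpose a b \<circ> p"
  shows "q \<circ> q = id" "q permutes insert a (insert b A)"
    "card (moved_pairs q) = Suc (card (moved_pairs p))"
proof -
  have pp: "p (p y) = y" for y
    using p(2) by (metis comp_apply id_apply)
  have out: "p a = a" "p b = b" using p(1) ab by (auto simp: permutes_not_in)
  have q: "q x = (if x = a then b else if x = b then a else p x)" for x
    using out pp by (metis comp_apply q_def transpose_apply_first transpose_apply_second
        transpose_apply_other)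
  show "q \<circ> q = id"
  proof
    fix x
    have "p x \<noteq> a" if "x \<noteq> a" using out pp[of x] that by auto
    moreover have "p x \<noteq> b" if "x \<noteq> b" using out pp[of x] that by auto
    ultimately show "(q \<circ> q) x = id x" using pp ab by (simp add: q)
  qed
  show "q permutes insert a (insert b A)"
    unfolding q_def
    by (rule permutes_compose[OF permutes_subset[OF p(1)] permutes_swap_id]) auto
  have eq: "moved_pairs q = insert {a, b} (moved_pairs p)"
    unfolding moved_pairs_def using out ab
    by (auto simp: q image_def split: if_splits)
  have "{a, b} \<notin> moved_pairs p"
    unfolding moved_pairs_def using out by (auto simp: doubleton_eq_iff)
  then show "card (moved_pairs q) = Suc (card (moved_pairs p))"
    using finite_moved_pairs[OF p(1) fin] by (simp add: eq)
qed

text \<open>An involution either fixes \<open>a\<close> or swaps it with some \<open>b\<close> in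
  \<open>A\<close>. Dissolving that 2-cycle into two fixed points leaves an involution of
  \<open>A - {b}\<close> of opposite parity.\<close>

lemma parity_involutions_insert:
  assumes a: "a \<notin> A" and fin: "finite A"
  shows "parity_involutions s (insert a A) = parity_involutions s A \<union>
    (\<Union>b\<in>A. (\<lambda>p. transpose a b \<circ> p) ` parity_involutions (\<not> s) (A - {b}))" (is "?L = ?R")
proof
  show "?L \<subseteq> ?R"
  proof
    fix q assume "q \<in> ?L"
    then have q: "q permutes insert a A" "q \<circ> q = id" "odd (card (moved_pairs q)) \<longleftrightarrow> s"
      by (auto simp: parity_involutions_def)
    have qq: "q (q y) = y" for y
      using q(2) by (metis comp_apply id_apply)
    show "q \<in> ?R"
    proof (cases "q a = a")
      case True
      then have "q permutes A" using q(1) by (metis permutes_superset DiffE insertE)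
      then show ?thesis using q by (auto simp: parity_involutions_def)
    next
      case False
      define b where "b = q a"
      have b: "b \<in> A" "b \<noteq> a" "q b = a" using q(1) False qq unfolding b_def
        by (metis insertE insertI1 permutes_in_image, simp_all)
      define p where "p = transpose a b \<circ> q"
      have qp: "q = transpose a b \<circ> p" by (auto simp: p_def fun_eq_iff)
      have p: "p x = (if x = a then a else if x = b then b else q x)" for x
        using b qq b_def by (auto simp: p_def transpose_def) metis+
      have pinv: "p \<circ> p = id" using qq b b_def by (auto simp: fun_eq_iff p) metis+
      have "p permutes insert a A" unfolding p_def
        by (rule permutes_compose[OF q(1) permutes_swap_id]) (use b in auto)
      then have pp: "p permutes (A - {b})"
        by (rule permutes_superset) (auto simp: p)
      have "card (moved_pairs q) = Suc (card (moved_pairs p))"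
        unfolding qp by (rule transpose_comp_involution(3)[OF pp pinv]) (use a b fin in auto)
      then have "p \<in> parity_involutions (\<not> s) (A - {b})"
        using q(3) pp pinv by (auto simp: parity_involutions_def)
      then show ?thesis using b(1) qp by blast
    qed
  qed
  show "?R \<subseteq> ?L"
  proof
    fix q assume "q \<in> ?R"
    then consider "q \<in> parity_involutions s A"
      | b p where "b \<in> A" "q = transpose a b \<circ> p" "p \<in> parity_involutions (\<not> s) (A - {b})"
      by blast
    then show "q \<in> ?L"
    proof cases
      case 1
      then show ?thesis by (auto simp: parity_involutions_def intro: permutes_subset)
    next
      case 2
      then have p: "p permutes (A - {b})" "p \<circ> p = id" "odd (card (moved_pairs p)) \<longleftrightarrow> \<not> s"
        by (auto simp: parity_involutions_def)
      have "a \<notin> A - {b}" "b \<notin> A - {b}" "a \<noteq> b" "finite (A - {b})" "insert b (A - {b}) = A"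
        using a 2 fin by auto
      from transpose_comp_involution[OF p(1,2) this(1-4)] this(5) show ?thesis
        using p(3) 2(2) by (simp add: parity_involutions_def)
    qed
  qed
qed

lemma card_parity_involutions:
  assumes "finite A"
  shows "card (parity_involutions s A) = inv_count s (card A)"
  using assms
proof (induction "card A" arbitrary: A s rule: less_induct)
  case less
  show ?case
  proof (cases "A = {}")
    case True
    have "parity_involutions s ({} :: 'a set) = (if s then {} else {id})"
      by (auto simp: parity_involutions_def moved_pairs_def)
    then show ?thesis using True by simp
  next
    case False
    then obtain a B where A: "A = insert a B" "a \<notin> B" by (meson equals0I mk_disjoint_insert)
    then have fin: "finite B" and cA: "card A = Suc (card B)" using less.prems by auto
    define F where "F b = (\<lambda>p. transpose a b \<circ> p) ` parity_involutions (\<not> s) (B - {b})" for b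
    \<comment> \<open>The value at \<open>a\<close> tells the sets \<open>F b\<close> apart from
      each other and from the involutions fixing \<open>a\<close>.\<close>
    have Fb: "q a = b" if "q \<in> F b" "b \<in> B" for q b
    proof -
      from that obtain p where p: "q = transpose a b \<circ> p" "p permutes (B - {b})"
        by (auto simp: F_def parity_involutions_def)
      then have "p a = a" using A by (auto simp: permutes_not_in)
      then show ?thesis using p by simp
    qed
    have fF: "finite (F b)" for b
      unfolding F_def using fin by (intro finite_imageI finite_parity_involutions) auto
    have cF: "card (F b) = inv_count (\<not> s) (card B - 1)" if "b \<in> B" for b
    proof -
      have "inj_on (\<lambda>p. transpose a b \<circ> p) (parity_involutions (\<not> s) (B - {b}))"
        by (rule inj_onI) (metis comp_assoc transpose_comp_involutory id_comp)
      then have "card (F b) = card (parity_involutions (\<not> s) (B - {b}))"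
        unfolding F_def by (rule card_image)
      also have "\<dots> = inv_count (\<not> s) (card (B - {b}))"
        by (rule less.hyps) (use that fin cA in \<open>auto simp: card_Diff_singleton\<close>)
      finally show ?thesis using that fin by (simp add: card_Diff_singleton)
    qed
    have disj: "parity_involutions s B \<inter> (\<Union>b\<in>B. F b) = {}"
    proof -
      have "q a = a" if "q \<in> parity_involutions s B" for q
        using that A by (auto simp: parity_involutions_def permutes_not_in)
      then show ?thesis using Fb A(2) by fastforce
    qed
    have "card (parity_involutions s A) = card (parity_involutions s B) + card (\<Union>b\<in>B. F b)"
      unfolding A(1) parity_involutions_insert[OF A(2) fin] F_def[symmetric]
      by (rule card_Un_disjoint) (use fin fF disj finite_parity_involutions in auto)
    also have "card (\<Union>b\<in>B. F b) = (\<Sum>b\<in>B. card (F b))"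
      by (rule card_UN_disjoint) (use fin fF Fb in \<open>auto, metis\<close>)
    also have "\<dots> = card B * inv_count (\<not> s) (card B - 1)" using cF by simp
    also have "card (parity_involutions s B) = inv_count s (card B)"
      by (rule less.hyps) (use cA fin in auto)
    \<comment> \<open>For empty \<open>B\<close> the truncated \<open>card B - 1\<close> does no
      harm, since its term has the factor \<open>card B\<close>.\<close>
    finally show ?thesis unfolding cA by (cases "card B") auto
  qed
qed

lemma t_odd_eq_inv_count: "t_odd n = inv_count True n"
  by (simp add: t_odd_eq_card card_parity_involutions)

section \<open>Four-step recurrences\<close>

text \<open>With \<open>x n\<close> the number of all involutions, \<open>total_e k\<close> is
  \<open>x (4 * k) - x (4 * k + 1)\<close> divided by \<open>4 * 2 ^ k\<close>. As
  \<open>x (4 * k + 5) - x (4 * k + 4) = 4 * (k + 1) * x (4 * k + 3)\<close>, its recurrence has the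
  factor \<open>k + 1\<close>, on which \<open>smooth_recurrence\<close> relies. The signed pair
  arises likewise.\<close>

fun total_b :: "nat \<Rightarrow> int" and total_e :: "nat \<Rightarrow> int" where
  "total_b 0 = 1"
| "total_e 0 = 0"
| "total_b (Suc k) = (24 * int k ^ 2 + 38 * int k + 13) * total_b k
     + 16 * (4 * int k + 1) * (int k + 1) * total_e k"
| "total_e (Suc k) = - 2 * (int k + 1) * ((2 * int k + 1) * total_b k + (4 * int k + 1) * total_e k)"

fun signed_b :: "nat \<Rightarrow> int" and signed_e :: "nat \<Rightarrow> int" where
  "signed_b 0 = 1"
| "signed_e 0 = 0"
| "signed_b (Suc k) = (24 * int k ^ 2 + 22 * int k + 3) * signed_b k
     + 4 * (4 * int k + 1) * (4 * int k + 3) * signed_e k"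
| "signed_e (Suc k) = - (int k + 1) * (4 * int k + 1) * (signed_b k + 2 * signed_e k)"

text \<open>The sign \<open>s\<close> is 1 for the total count and -1 for the signed one.\<close>

lemma four_step:
  fixes x :: "nat \<Rightarrow> int"
  assumes rec: "\<And>n. x (Suc (Suc n)) = x (Suc n) + s * (int n + 1) * x n" and s: "s * s = 1"
  defines "y \<equiv> \<lambda>k. x (4 * k)" and "z \<equiv> \<lambda>k. x (4 * k + 1)"
  shows "y (Suc k) = (1 + s * (8 * int k + 5)) * z k
           + (s * (4 * int k + 1) + (4 * int k + 3) * (4 * int k + 1)) * y k"
    and "z (Suc k) = (1 + s * (8 * int k + 5) + s * (4 * int k + 4) * (1 + s * (4 * int k + 2))) * z k
           + (s * (4 * int k + 1) + (4 * int k + 3) * (4 * int k + 1)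
              + (4 * int k + 4) * (4 * int k + 1)) * y k"
proof -
  have 2: "x (4 * k + 2) = z k + s * (4 * int k + 1) * y k"
    using rec[of "4 * k"] by (simp add: y_def z_def)
  have "x (4 * k + 3) = x (4 * k + 2) + s * (4 * int k + 2) * z k"
    using rec[of "4 * k + 1"] by (simp add: z_def numeral_eq_Suc)
  then have 3: "x (4 * k + 3) = (1 + s * (4 * int k + 2)) * z k + s * (4 * int k + 1) * y k"
    unfolding 2 by algebra
  have "y (Suc k) = x (4 * k + 3) + s * (4 * int k + 3) * x (4 * k + 2)"
    using rec[of "4 * k + 2"] by (simp add: y_def numeral_eq_Suc)
  then show 4: "y (Suc k) = (1 + s * (8 * int k + 5)) * z k
           + (s * (4 * int k + 1) + (4 * int k + 3) * (4 * int k + 1)) * y k"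
    unfolding 3 2 using s by algebra
  have "z (Suc k) = y (Suc k) + s * (4 * int k + 4) * x (4 * k + 3)"
    using rec[of "4 * k + 3"] by (simp add: y_def z_def numeral_eq_Suc)
  then show "z (Suc k) = (1 + s * (8 * int k + 5) + s * (4 * int k + 4) * (1 + s * (4 * int k + 2))) * z k
           + (s * (4 * int k + 1) + (4 * int k + 3) * (4 * int k + 1)
              + (4 * int k + 4) * (4 * int k + 1)) * y k"
    unfolding 4 3 using s by algebra
qed

lemma total_count:
  "int (inv_count False (4 * k)) + int (inv_count True (4 * k)) = 2 ^ k * (total_b k + 4 * total_e k)"
  "int (inv_count False (4 * k + 1)) + int (inv_count True (4 * k + 1)) = 2 ^ k * total_b k"
proof -
  define x where "x n = int (inv_count False n) + int (inv_count True n)" for n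
  have rec: "x (Suc (Suc n)) = x (Suc n) + 1 * (int n + 1) * x n" for n
    by (simp add: x_def algebra_simps)
  have "x (4 * k) = 2 ^ k * (total_b k + 4 * total_e k) \<and> x (4 * k + 1) = 2 ^ k * total_b k"
  proof (induction k)
    case 0
    then show ?case by (simp add: x_def)
  next
    case (Suc k)
    from four_step[of x 1 k, OF rec] show ?case
      unfolding Suc[THEN conjunct1] Suc[THEN conjunct2]
      by (simp add: algebra_simps power2_eq_square)
  qed
  then show "int (inv_count False (4 * k)) + int (inv_count True (4 * k)) = 2 ^ k * (total_b k + 4 * total_e k)"
    "int (inv_count False (4 * k + 1)) + int (inv_count True (4 * k + 1)) = 2 ^ k * total_b k"
    unfolding x_def by auto
qed

lemma signed_count:
  "int (inv_count False (4 * k)) - int (inv_count True (4 * k)) = 2 ^ k * (signed_b k + 4 * signed_e k)"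
  "int (inv_count False (4 * k + 1)) - int (inv_count True (4 * k + 1)) = 2 ^ k * signed_b k"
proof -
  define x where "x n = int (inv_count False n) - int (inv_count True n)" for n
  have rec: "x (Suc (Suc n)) = x (Suc n) + (-1) * (int n + 1) * x n" for n
    by (simp add: x_def algebra_simps)
  have "x (4 * k) = 2 ^ k * (signed_b k + 4 * signed_e k) \<and> x (4 * k + 1) = 2 ^ k * signed_b k"
  proof (induction k)
    case 0
    then show ?case by (simp add: x_def)
  next
    case (Suc k)
    from four_step[of x "-1" k, OF rec] show ?case
      unfolding Suc[THEN conjunct1] Suc[THEN conjunct2]
      by (simp add: algebra_simps power2_eq_square)
  qed
  then show "int (inv_count False (4 * k)) - int (inv_count True (4 * k)) = 2 ^ k * (signed_b k + 4 * signed_e k)"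
    "int (inv_count False (4 * k + 1)) - int (inv_count True (4 * k + 1)) = 2 ^ k * signed_b k"
    unfolding x_def by auto
qed

lemma double_inv_count_True:
  "2 * int (inv_count True (4 * k + 1)) = 2 ^ k * (total_b k - signed_b k)"
  using total_count(2)[of k] signed_count(2)[of k] by (simp add: algebra_simps)

section \<open>Sequences with 2-adically small differences\<close>

text \<open>\<open>smooth J f\<close> says that \<open>2 ^ j\<close> divides the \<open>j\<close>-th differences of \<open>f\<close> for all \<open>j \<le> J\<close>.\<close>

primrec smooth :: "nat \<Rightarrow> (nat \<Rightarrow> int) \<Rightarrow> bool" where
  "smooth 0 f \<longleftrightarrow> True"
| "smooth (Suc J) f \<longleftrightarrow> (\<exists>g. (\<forall>l. f (Suc l) = f l + 2 * g l) \<and> smooth J g)"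

lemma smooth_SucD: "smooth (Suc J) f \<Longrightarrow> smooth J f"
proof (induction J arbitrary: f)
  case (Suc J)
  then obtain g where "\<And>l. f (Suc l) = f l + 2 * g l" "smooth (Suc J) g"
    unfolding smooth.simps(2)[of "Suc J"] by blast
  then show ?case using Suc.IH by auto
qed simp

lemma smooth_add: "smooth J f \<Longrightarrow> smooth J g \<Longrightarrow> smooth J (\<lambda>l. f l + g l)"
proof (induction J arbitrary: f g)
  case (Suc J)
  then obtain f' g' where *: "\<And>l. f (Suc l) = f l + 2 * f' l" "smooth J f'"
    "\<And>l. g (Suc l) = g l + 2 * g' l" "smooth J g'" by auto
  show ?case unfolding smooth.simps
    by (rule exI[of _ "\<lambda>l. f' l + g' l"]) (use * Suc.IH in \<open>auto simp: algebra_simps\<close>)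
qed simp

lemma smooth_scale: "smooth J f \<Longrightarrow> smooth J (\<lambda>l. c * f l)"
proof (induction J arbitrary: f)
  case (Suc J)
  then obtain f' where *: "\<And>l. f (Suc l) = f l + 2 * f' l" "smooth J f'" by auto
  show ?case unfolding smooth.simps
    by (rule exI[of _ "\<lambda>l. c * f' l"]) (use * Suc.IH in \<open>auto simp: algebra_simps\<close>)
qed simp

lemma smooth_diff: "smooth J f \<Longrightarrow> smooth J g \<Longrightarrow> smooth J (\<lambda>l. f l - g l)"
  using smooth_add[of J f "\<lambda>l. - 1 * g l"] smooth_scale[of J g "-1"] by simp

lemma smooth_shift: "smooth J f \<Longrightarrow> smooth J (\<lambda>l. f (Suc l))"
proof (induction J arbitrary: f)
  case (Suc J)
  then obtain g where g: "\<And>l. f (Suc l) = f l + 2 * g l" "smooth J g" by auto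
  have "smooth J (\<lambda>l. g (Suc l))" using Suc.IH g(2) by blast
  then show ?case using g(1) by (auto intro!: exI[of _ "\<lambda>l. g (Suc l)"])
qed simp

text \<open>A factor 2 buys one more order: half the difference of \<open>2 * f\<close> is the plain
  difference of \<open>f\<close>, which is as smooth as \<open>f\<close>.\<close>

lemma smooth_double:
  assumes "smooth J f"
  shows "smooth (Suc J) (\<lambda>l. 2 * f l)"
  unfolding smooth.simps
  by (rule exI[of _ "\<lambda>l. f (Suc l) - f l"])
    (use smooth_diff[OF smooth_shift assms] assms in auto)

text \<open>The factor \<open>2 * int l\<close> grows by 2 at each step, so the product rule again
  yields twice a smooth sequence. The factor \<open>int l\<close> alone would not do.\<close>

lemma smooth_mult_even: "smooth J f \<Longrightarrow> smooth J (\<lambda>l. 2 * int l * f l)"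
proof (induction J arbitrary: f)
  case (Suc J)
  then obtain g where *: "\<And>l. f (Suc l) = f l + 2 * g l" "smooth J g" by auto
  have "smooth J (\<lambda>l. f l + 2 * int l * g l + 2 * g l)"
    using smooth_SucD[OF Suc.prems] * Suc.IH by (intro smooth_add smooth_scale) auto
  then show ?case unfolding smooth.simps
    by (intro exI[of _ "\<lambda>l. f l + 2 * int l * g l + 2 * g l"]) (auto simp: * algebra_simps)
qed simp

lemma smooth_mult_poly: "smooth J f \<Longrightarrow> smooth J (\<lambda>l. poly p (2 * int l) * f l)"
proof (induction p)
  case 0
  then show ?case using smooth_scale[of J f 0] by simp
next
  case (pCons a p)
  have "smooth J (\<lambda>l. a * f l + 2 * int l * (poly p (2 * int l) * f l))"
    using pCons by (intro smooth_add smooth_scale smooth_mult_even) auto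
  then show ?case by (simp add: algebra_simps)
qed

text \<open>To extend backwards, first choose the missing halved difference \<open>a\<close>,
  recursively; then \<open>f 1 - 2 * a\<close> is forced as the value at 0.\<close>

lemma smooth_extend:
  "smooth J (\<lambda>l. f (Suc l)) \<Longrightarrow> \<exists>a. smooth J (f(0 := a))"
proof (induction J arbitrary: f)
  case (Suc J)
  then obtain g where g: "\<And>l. f (Suc (Suc l)) = f (Suc l) + 2 * g l" "smooth J g" by auto
  define h where "h = case_nat 0 g"
  have "smooth J (\<lambda>l. h (Suc l))" using g(2) by (simp add: h_def)
  then obtain a where a: "smooth J (h(0 := a))" using Suc.IH by blast
  have "smooth (Suc J) (f(0 := f 1 - 2 * a))" unfolding smooth.simps
  proof (intro exI[of _ "h(0 := a)"] conjI allI a)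
    fix l show "(f(0 := f 1 - 2 * a)) (Suc l) = (f(0 := f 1 - 2 * a)) l + 2 * (h(0 := a)) l"
      by (cases l) (auto simp: h_def g)
  qed
  then show ?case by blast
qed simp

text \<open>Since \<open>e l = l * c l\<close>, the value \<open>c 0\<close> is irrelevant to the recurrence; the value that
  continues \<open>c\<close> 2-adically is only known modulo \<open>2 ^ J\<close>, so it is chosen afresh for each \<open>J\<close>.\<close>

lemma smooth_recurrence:
  fixes b e :: "nat \<Rightarrow> int"
  assumes b: "\<And>l. b (Suc l) = b l + 2 * (poly B1 (2 * int l) * b l) + 4 * (poly B2 (2 * int l) * e l)"
    and e: "\<And>l. e (Suc l) = (int l + 1) * (4 * (poly P (2 * int l) * e l) + poly Q (2 * int l) * b l)"
    and e0: "e 0 = 0"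
  shows "smooth J b"
proof -
  \<comment> \<open>This is the quotient of \<open>e l\<close> by \<open>l\<close> for positive
    \<open>l\<close>; the 0 is a placeholder that \<open>c(0 := a)\<close> overwrites.\<close>
  define c where "c = case_nat 0 (\<lambda>l. 4 * (poly P (2 * int l) * e l) + poly Q (2 * int l) * b l)"
  have ec: "e l = int l * (c(0 := a)) l" for l a
    by (cases l) (auto simp: c_def e0 e)
  have "smooth J b \<and> (\<exists>a. smooth J (c(0 := a)))"
  proof (induction J)
    case (Suc J)
    then obtain a where sb: "smooth J b" and sc: "smooth J (c(0 := a))" by blast
    let ?c = "c(0 := a)"
    \<comment> \<open>Since \<open>4 * e l = 2 * (2 * l * c l)\<close>, half the difference of
      \<open>b\<close> involves \<open>b\<close> and \<open>c\<close> only at order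
      \<open>J\<close>.\<close>
    have "smooth J (\<lambda>l. poly B1 (2 * int l) * b l + poly B2 (2 * int l) * (2 * int l * ?c l))"
      by (intro smooth_add smooth_mult_poly smooth_mult_even sb sc)
    then have sb': "smooth (Suc J) b" unfolding smooth.simps
      by (intro exI[of _ "\<lambda>l. poly B1 (2 * int l) * b l + poly B2 (2 * int l) * (2 * int l * ?c l)"])
        (simp only: b ec[of _ a] sb, simp add: algebra_simps)
    \<comment> \<open>The term in \<open>c\<close> has a spare factor 2, which lifts it from order
      \<open>J\<close> by \<open>smooth_double\<close>; \<open>b\<close> has just reached the new
      order.\<close>
    have "smooth (Suc J) (\<lambda>l. 2 * (poly P (2 * int l) * (2 * int l * ?c l)) + poly Q (2 * int l) * b l)"
      by (intro smooth_add smooth_mult_poly smooth_mult_even smooth_double sb' sc)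
    also have "(\<lambda>l. 2 * (poly P (2 * int l) * (2 * int l * ?c l)) + poly Q (2 * int l) * b l)
        = (\<lambda>l. c (Suc l))"
    proof
      fix l
      have "c (Suc l) = 4 * (poly P (2 * int l) * e l) + poly Q (2 * int l) * b l"
        by (simp add: c_def)
      also have "e l = int l * ?c l" by (rule ec)
      finally show "2 * (poly P (2 * int l) * (2 * int l * ?c l)) + poly Q (2 * int l) * b l
        = c (Suc l)" by simp
    qed
    finally show ?case using sb' smooth_extend by blast
  qed simp
  then show ?thesis ..
qed

text \<open>The polynomials below arise by composing two steps of the recurrence in \<open>k\<close>, starting
  from \<open>k = 2 * l\<close>; their argument is \<open>k\<close>.\<close>

lemma smooth_total_b: "smooth J (\<lambda>l. total_b (2 * l))"
\<comment> \<open>In \<open>B1\<close>, the first polynomial is half of \<open>(24 * (k + 1)^2 + 38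
  * (k + 1) + 13) * (24 * k^2 + 38 * k + 13) - 1\<close>, the route through
  \<open>total_b (k + 1)\<close>; the subtracted product is the route through
  \<open>total_e (k + 1)\<close>.\<close>
proof (rule smooth_recurrence[where e = "\<lambda>l. total_e (2 * l)"
      and ?B1.0 = "[:487, 1984, 2690, 1488, 288:] - [:16:] * [:5, 4:] * [:2, 1:] * [:1, 1:] * [:1, 2:]"
      and ?B2.0 = "[:4:] * [:1, 4:] * [:1, 1:] * [:75, 86, 24:] - [:8:] * [:5, 4:] * [:2, 1:] * [:1, 1:] * [:1, 4:]"
      and P = "[:2:] * [:5, 4:] * [:1, 1:] * [:1, 4:] - [:16:] * [:3, 2:] * [:1, 4:] * [:1, 1:]"
      and Q = "[:8:] * [:5, 4:] * [:1, 1:] * [:1, 2:] - [:4:] * [:3, 2:] * [:13, 38, 24:]"])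
  fix l
  have k: "2 * Suc l = Suc (Suc (2 * l))" by simp
  show "total_b (2 * Suc l) = total_b (2 * l)
     + 2 * (poly ([:487, 1984, 2690, 1488, 288:] - [:16:] * [:5, 4:] * [:2, 1:] * [:1, 1:] * [:1, 2:]) (2 * int l)
         * total_b (2 * l))
     + 4 * (poly ([:4:] * [:1, 4:] * [:1, 1:] * [:75, 86, 24:] - [:8:] * [:5, 4:] * [:2, 1:] * [:1, 1:] * [:1, 4:])
         (2 * int l) * total_e (2 * l))"
    unfolding k total_b.simps total_e.simps poly_add poly_diff poly_minus poly_mult
    by (simp del: mult_pCons_left mult_pCons_right) algebra
  show "total_e (2 * Suc l) = (int l + 1)
     * (4 * (poly ([:2:] * [:5, 4:] * [:1, 1:] * [:1, 4:] - [:16:] * [:3, 2:] * [:1, 4:] * [:1, 1:]) (2 * int l)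
         * total_e (2 * l))
       + poly ([:8:] * [:5, 4:] * [:1, 1:] * [:1, 2:] - [:4:] * [:3, 2:] * [:13, 38, 24:]) (2 * int l)
         * total_b (2 * l))"
    unfolding k total_b.simps total_e.simps poly_add poly_diff poly_minus poly_mult
    by (simp del: mult_pCons_left mult_pCons_right) algebra
qed simp

lemma smooth_signed_b: "smooth J (\<lambda>l. signed_b (2 * l))"
proof (rule smooth_recurrence[where e = "\<lambda>l. signed_e (2 * l)"
      and ?B1.0 = "[:73, 644, 1394, 1104, 288:] - [:2:] * [:5, 4:] * [:7, 4:] * [:1, 1:] * [:1, 4:]"
      and ?B2.0 = "[:1, 4:] * [:3, 4:] * [:49, 70, 24:]
        - [:2:] * [:5, 4:] * [:7, 4:] * [:1, 1:] * [:1, 4:]"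
      and P = "- [:2:] * [:5, 4:] * ([:1, 4:] * [:3, 4:] - [:1, 1:] * [:1, 4:])"
      and Q = "- [:2:] * [:5, 4:] * ([:3, 22, 24:] - [:2:] * [:1, 1:] * [:1, 4:])"])
  fix l
  have k: "2 * Suc l = Suc (Suc (2 * l))" by simp
  show "signed_b (2 * Suc l) = signed_b (2 * l) + 2 * (poly ([:73, 644, 1394, 1104, 288:]
      - [:2:] * [:5, 4:] * [:7, 4:] * [:1, 1:] * [:1, 4:]) (2 * int l) * signed_b (2 * l))
     + 4 * (poly ([:1, 4:] * [:3, 4:] * [:49, 70, 24:]
        - [:2:] * [:5, 4:] * [:7, 4:] * [:1, 1:] * [:1, 4:]) (2 * int l) * signed_e (2 * l))"
    unfolding k signed_b.simps signed_e.simps poly_add poly_diff poly_minus poly_mult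
    by (simp del: mult_pCons_left mult_pCons_right) algebra
  show "signed_e (2 * Suc l) = (int l + 1) * (4 * (poly (- [:2:] * [:5, 4:]
      * ([:1, 4:] * [:3, 4:] - [:1, 1:] * [:1, 4:])) (2 * int l) * signed_e (2 * l))
     + poly (- [:2:] * [:5, 4:] * ([:3, 22, 24:] - [:2:] * [:1, 1:] * [:1, 4:])) (2 * int l)
       * signed_b (2 * l))"
    unfolding k signed_b.simps signed_e.simps poly_add poly_diff poly_minus poly_mult
    by (simp del: mult_pCons_left mult_pCons_right) algebra
qed simp

section \<open>Newton expansion\<close>

definition fdiff :: "(nat \<Rightarrow> int) \<Rightarrow> nat \<Rightarrow> int" where
  "fdiff f l = f (Suc l) - f l"

lemma fdiff_funpow_scale: "(fdiff ^^ j) (\<lambda>l. c * f l) = (\<lambda>l. c * (fdiff ^^ j) f l)"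
  by (induction j) (auto simp: fdiff_def fun_eq_iff algebra_simps)

text \<open>The induction hypothesis is used for both \<open>f\<close> and \<open>fdiff f\<close>;
  Pascal's rule merges the two sums.\<close>

lemma newton_forward: "f n = (\<Sum>j\<le>n. int (n choose j) * (fdiff ^^ j) f 0)"
proof (induction n arbitrary: f)
  case (Suc n)
  let ?d = "\<lambda>j. (fdiff ^^ j) f 0"
  have "f (Suc n) = f n + fdiff f n" by (simp add: fdiff_def)
  also have "fdiff f n = (\<Sum>j\<le>n. int (n choose j) * ?d (Suc j))"
    using Suc.IH[of "fdiff f"] by (simp add: funpow_swap1)
  also have "f n = (\<Sum>j\<le>Suc n. int (n choose j) * ?d j)"
    using Suc.IH[of f] by simp
  also have "\<dots> = ?d 0 + (\<Sum>j\<le>n. int (n choose Suc j) * ?d (Suc j))"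
    by (subst sum.atMost_Suc_shift) simp
  finally have "f (Suc n) = ?d 0 + (\<Sum>j\<le>n. int (Suc n choose Suc j) * ?d (Suc j))"
    by (simp add: sum.distrib algebra_simps)
  then show ?case by (subst sum.atMost_Suc_shift) simp
qed simp

lemma smooth_fdiff_dvd: "smooth J f \<Longrightarrow> 2 ^ J dvd (fdiff ^^ J) f l"
proof (induction J arbitrary: f l)
  case (Suc J)
  then obtain g where g: "\<And>l. f (Suc l) = f l + 2 * g l" "smooth J g" by auto
  have "fdiff f = (\<lambda>l. 2 * g l)" by (auto simp: fdiff_def g)
  then have "(fdiff ^^ Suc J) f = (\<lambda>l. 2 * (fdiff ^^ J) g l)"
    using fdiff_funpow_scale[of J 2 g] by (simp add: funpow_swap1)
  then show ?case using Suc.IH[OF g(2)] by simp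
qed simp

text \<open>By absorption, \<open>j * (l choose j)\<close> is a multiple of \<open>l\<close>; the
  odd part \<open>w\<close> of \<open>j\<close> can then be cancelled.\<close>

lemma pow2_dvd_mult_binomial:
  assumes "2 ^ m dvd l" "odd w" "0 < 2 ^ v * w"
  shows "(2::nat) ^ m dvd 2 ^ v * (l choose (2 ^ v * w))"
proof (cases l)
  case 0
  then show ?thesis using assms by (simp add: binomial_eq_0)
next
  case (Suc n)
  obtain j where j: "2 ^ v * w = Suc j" using assms(3) gr0_conv_Suc by blast
  have "(2 ^ v * w) * (l choose (2 ^ v * w)) = l * (n choose j)"
    unfolding j Suc by (rule Suc_times_binomial)
  then have "2 ^ m dvd w * (2 ^ v * (l choose (2 ^ v * w)))"
    using assms(1) by (metis dvd_mult2 mult.assoc mult.commute)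
  moreover have "coprime (2 ^ m) w" using assms(2) by simp
  ultimately show ?thesis using coprime_dvd_mult_right_iff by blast
qed

text \<open>By \<open>double_inv_count_True\<close>,
  \<open>2 * t_odd (8 * l + 1) = 2 ^ (2 * l) * gap l\<close>.\<close>

definition gap :: "nat \<Rightarrow> int" where
  "gap l = total_b (2 * l) - signed_b (2 * l)"

lemma gap_values: "gap 0 = 0" "gap 1 = 648" "gap 2 = 13806992" "gap 3 = 1524796947000"
  "gap 4 = 548790773768435616"
  by code_simp+

lemma smooth_gap: "smooth J gap"
  unfolding gap_def[abs_def] by (intro smooth_diff smooth_total_b smooth_signed_b)

text \<open>The \<open>v\<close> pays for the denominator of \<open>l choose j\<close>, and 4 is one
  more than the 2-adic order of 648. Smoothness gives exponent \<open>j\<close>, which suffices from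
  \<open>j = 5\<close> on; for 2, 3, 4 the needed exponents 5, 4, 6 are larger and come from
  explicit values.\<close>

lemma gap_fdiff_dvd:
  assumes "2 \<le> j"
  shows "\<exists>v w. j = 2 ^ v * w \<and> odd w \<and> 2 ^ (v + 4) dvd (fdiff ^^ j) gap 0"
proof -
  consider "j = 2" | "j = 3" | "j = 4" | "5 \<le> j" using assms by linarith
  then show ?thesis
  proof cases
    case 1
    have "2 ^ (1 + 4) dvd (fdiff ^^ 2) gap 0"
      using gap_values by (simp add: fdiff_def eval_nat_numeral)
    then show ?thesis unfolding 1 by (intro exI[of _ 1]) auto
  next
    case 2
    have "2 ^ (0 + 4) dvd (fdiff ^^ 3) gap 0"
      using gap_values by (simp add: fdiff_def eval_nat_numeral)
    then show ?thesis unfolding 2 by (intro exI[of _ 0] exI[of _ 3]) auto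
  next
    case 3
    have "2 ^ (2 + 4) dvd (fdiff ^^ 4) gap 0"
      using gap_values by (simp add: fdiff_def eval_nat_numeral)
    then show ?thesis unfolding 3 by (intro exI[of _ 2] exI[of _ 1]) auto
  next
    case 4
    then obtain w where w: "j = 2 ^ multiplicity 2 j * w" "odd w"
      using multiplicity_decompose'[of j 2] by auto
    define v where "v = multiplicity 2 j"
    have j: "j = 2 ^ v * w" using w(1) by (simp add: v_def)
    have "w > 0" using w(2) by (rule odd_pos)
    have "v + 4 \<le> j"
    proof (cases "v \<le> 3")
      case True
      then consider "v = 0" | "v = 1" | "v = 2" | "v = 3" by linarith
      then show ?thesis using j \<open>w > 0\<close> \<open>5 \<le> j\<close> by cases (simp_all, presburger+)
    next
      case False
      then have "4 \<le> v" by simp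
      then have "v + 4 \<le> 2 ^ v" by (induction v rule: dec_induct) auto
      also have "\<dots> \<le> j" using j \<open>w > 0\<close> by simp
      finally show ?thesis .
    qed
    then have "2 ^ (v + 4) dvd (fdiff ^^ j) gap 0"
      using smooth_fdiff_dvd[OF smooth_gap] power_le_dvd by blast
    then show ?thesis using j w(2) by blast
  qed
qed

text \<open>The Newton terms for \<open>j = 0\<close> and \<open>j = 1\<close> are 0 and
  \<open>648 * l\<close>. In every other term \<open>2 ^ v\<close> from the difference combines with
  the binomial to \<open>2 ^ m\<close>, and \<open>2 ^ 4\<close> is left over.\<close>

lemma gap_cong:
  assumes l: "2 ^ m dvd l" "0 < l"
  shows "2 ^ (m + 4) dvd gap l - 648 * int l"
proof -
  let ?c = "\<lambda>j. (fdiff ^^ j) gap 0"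
  have "gap l = (\<Sum>j\<in>{..l}. int (l choose j) * ?c j)" by (rule newton_forward)
  also have "{..l} = insert 0 (insert 1 {2..l})" using l(2) by auto
  also have "(\<Sum>j\<in>\<dots>. int (l choose j) * ?c j)
      = 648 * int l + (\<Sum>j=2..l. int (l choose j) * ?c j)"
    using gap_values by (simp add: fdiff_def)
  finally have "gap l - 648 * int l = (\<Sum>j=2..l. int (l choose j) * ?c j)" by simp
  also have "2 ^ (m + 4) dvd \<dots>"
  proof (rule dvd_sum)
    fix j assume "j \<in> {2..l}"
    then have "2 \<le> j" by simp
    then obtain v w x where j: "j = 2 ^ v * w" "odd w" and x: "?c j = 2 ^ (v + 4) * x"
      using gap_fdiff_dvd unfolding dvd_def by blast
    have "2 ^ m dvd 2 ^ v * (l choose j)"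
      using pow2_dvd_mult_binomial[OF l(1) j(2), of v] \<open>2 \<le> j\<close>
      unfolding j(1)[symmetric] by simp
    then have "int (2 ^ m) dvd int (2 ^ v * (l choose j))" by (simp only: of_nat_dvd_iff)
    then have "2 ^ m * 2 ^ 4 dvd (2 ^ v * int (l choose j)) * (2 ^ 4 * x)"
      by (intro mult_dvd_mono) auto
    then show "2 ^ (m + 4) dvd int (l choose j) * ?c j"
      unfolding x by (simp add: power_add mult_ac)
  qed
  finally show ?thesis .
qed

section \<open>The 2-adic order\<close>

lemma ord2_eqI:
  assumes "int n = 2 ^ N * z" "odd z"
  shows "ord2 n = enat N"
proof -
  have "multiplicity 2 n = N"
  proof (rule multiplicity_eqI)
    have "int (2 ^ N) dvd int n" using assms(1) by simp
    then show "2 ^ N dvd n" by (simp only: of_nat_dvd_iff)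
    show "\<not> 2 ^ Suc N dvd n"
    proof
      assume "2 ^ Suc N dvd n"
      then have "int (2 ^ Suc N) dvd int n" by (simp only: of_nat_dvd_iff)
      then show False using assms by simp
    qed
  qed
  moreover have "n \<noteq> 0" using assms by (cases "n = 0") auto
  ultimately show ?thesis by (simp add: ord2_def)
qed

text \<open>Modulo 4 the coefficient of \<open>total_e\<close> vanishes, so the recurrence
  decouples.\<close>

lemma total_b_mod_4: "4 dvd total_b (Suc k) - (2 * int k + 1) * total_b k"
  by (rule dvdI[where k = "(6 * int k ^ 2 + 9 * int k + 3) * total_b k
        + 4 * (4 * int k + 1) * (int k + 1) * total_e k"])
    (simp add: algebra_simps power2_eq_square)

lemma signed_b_mod_4: "4 dvd signed_b (Suc k) - (2 * int k + 3) * signed_b k"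
  by (rule dvdI[where k = "(6 * int k ^ 2 + 5 * int k) * signed_b k
        + (4 * int k + 1) * (4 * int k + 3) * signed_e k"])
    (simp add: algebra_simps power2_eq_square)

text \<open>Two steps multiply by \<open>(2 * k + 1) * (2 * k + 3) = 4 * (k + 1)^2 - 1\<close>,
  which is -1 modulo 4.\<close>

lemma total_b_double_step: "4 dvd total_b (Suc (Suc k)) + total_b k"
proof -
  obtain x y where "total_b (Suc k) - (2 * int k + 1) * total_b k = 4 * x"
    "total_b (Suc (Suc k)) - (2 * int (Suc k) + 1) * total_b (Suc k) = 4 * y"
    using total_b_mod_4 unfolding dvd_def by meson
  then have "total_b (Suc (Suc k)) + total_b k
      = 4 * ((int k ^ 2 + 2 * int k + 1) * total_b k + (2 * int k + 3) * x + y)"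
    unfolding of_nat_Suc by algebra
  then show ?thesis by (rule dvdI)
qed

lemma signed_b_double_step: "4 dvd signed_b (Suc (Suc k)) + signed_b k"
proof -
  obtain x y where "signed_b (Suc k) - (2 * int k + 3) * signed_b k = 4 * x"
    "signed_b (Suc (Suc k)) - (2 * int (Suc k) + 3) * signed_b (Suc k) = 4 * y"
    using signed_b_mod_4 unfolding dvd_def by meson
  then have "signed_b (Suc (Suc k)) + signed_b k
      = 4 * ((int k ^ 2 + 4 * int k + 4) * signed_b k + (2 * int k + 5) * x + y)"
    unfolding of_nat_Suc by algebra
  then show ?thesis by (rule dvdI)
qed

text \<open>Double steps negate both sequences modulo 4, and the start values are 13 and 3.\<close>

lemma odd_index_mod_4:
  "odd (total_b (2 * l + 1)) \<and> 4 dvd total_b (2 * l + 1) + signed_b (2 * l + 1)"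
proof (induction l)
  case (Suc l)
  have "2 * Suc l + 1 = Suc (Suc (2 * l + 1))" by simp
  then show ?case
    using Suc total_b_double_step[of "2 * l + 1"] signed_b_double_step[of "2 * l + 1"]
    by presburger
qed simp

theorem theorem5p5:
  fixes k :: nat
  shows "ord2 (t_odd (4 * k + 1)) = enat k + ord2 k + enat (chi_even k)"
proof (cases "even k")
  case False
  then obtain l where k: "k = 2 * l + 1" by (rule oddE)
  obtain y where "total_b k + signed_b k = 4 * y" "odd (total_b k)"
    using odd_index_mod_4[of l] unfolding k by blast
  then have y: "total_b k - signed_b k = 2 * (total_b k - 2 * y)" "odd (total_b k - 2 * y)" by auto
  have "int (t_odd (4 * k + 1)) = 2 ^ k * (total_b k - 2 * y)"
    using double_inv_count_True[of k] unfolding t_odd_eq_inv_count y(1) mult.left_commute[of _ 2]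
    by (simp only: mult_cancel_left) simp
  then have "ord2 (t_odd (4 * k + 1)) = enat k" using y(2) by (rule ord2_eqI)
  moreover have "ord2 k = enat 0" by (rule ord2_eqI[of _ _ "int k"]) (use False in auto)
  ultimately show ?thesis using False by (simp add: chi_even_def)
next
  case True
  then obtain l where k: "k = 2 * l" by (rule evenE)
  show ?thesis
  proof (cases "l = 0")
    case True
    \<comment> \<open>For \<open>k = 0\<close> both sides are infinite, as
      \<open>t_odd 1 = 0\<close>.\<close>
    then show ?thesis by (simp add: k t_odd_eq_inv_count ord2_def)
  next
    case False
    then obtain u where u: "l = 2 ^ multiplicity 2 l * u" "odd u"
      using multiplicity_decompose'[of l 2] by auto
    define m where "m = multiplicity 2 l"
    have l: "l = 2 ^ m * u" using u(1) by (simp add: m_def)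
    obtain y where "gap l - 648 * int l = 2 ^ (m + 4) * y"
      using gap_cong[of m l] l False unfolding dvd_def by auto
    \<comment> \<open>Here \<open>648 = 2 ^ 3 * 81\<close>, so the error
      \<open>2 ^ (m + 4) * y\<close> leaves the cofactor odd.\<close>
    then have gap: "gap l = 2 ^ (m + 3) * (81 * int u + 2 * y)"
      by (simp add: l power_add algebra_simps)
    have "2 * int (t_odd (4 * k + 1)) = 2 ^ k * gap l"
      using double_inv_count_True[of k] by (simp add: t_odd_eq_inv_count gap_def k)
    then have "int (t_odd (4 * k + 1)) = 2 ^ (k + m + 2) * (81 * int u + 2 * y)"
      unfolding gap by (simp add: power_add)
    then have "ord2 (t_odd (4 * k + 1)) = enat (k + m + 2)"
      by (rule ord2_eqI) (use u(2) in auto)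
    moreover have "ord2 k = enat (m + 1)"
      by (rule ord2_eqI[of _ _ "int u"]) (use u(2) in \<open>auto simp: k l\<close>)
    ultimately show ?thesis using True by (simp add: chi_even_def)
  qed
qed

end
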